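(* Let $G=(V,E,\mu)$ be a finite weighted digraph with strictly positive weights (resistances) $(\mu_e \mid e\in E)$, let $a,b,c\in V$ be three arbitrary nodes, and let $r>0$ and $s>0$ be real parameters. For nodes $u,v$ let $\mu_{u,v}\in[0,+\infty]$ denote the effective resistance from $u$ to $v$ of the circuit $G$ with parameters $r,s$. Then $$\mu_{a,b}^{s/r}\le \mu_{a,c}^{s/r}+\mu_{c,b}^{s/r}.$$ Moreover, equality holds if and only if the node $c$ belongs to every directed path from $a$ to $b$ in $G$.
   Context: Circuit. $G=(V,E,\mu)$ is a finite digraph (parallel edges allowed), each directed edge $e$ having a resistance $\mu_e>0$; $r,s>0$ are real parameters common to all edges. A potential vector $x=(x_v)_{v\in V}\in\mathbb{R}^V$ determines: - voltages $y_e=x_{v'}-x_{v''}$ for each directed edge $e=(v',v'')$ (from $v'$ to $v''$); - currents $y_e^*=y_e^r/\mu_e^s$ if $y_e\ge 0$, and $y_e^*=0$ if $y_e\le 0$; - fluxes $x_v^*=\sum_{e \text{ begins at } v}y_e^*-\sum_{e\text{ ends at }v}y_e^*$ for $v\in V$. Solution of a two-pole circuit. For distinct nodes $u,w$ and reals $x_u^0\ge x_w^0$, a solution of $(G,u,w)$ is a potential vector $x$ with $x_u=x_u^0$, $x_w=x_w^0$, and $x_v^*=0$ for all $v\in V\setminus\{u,w\}$. Put $y_{u,w}=x_u^0-x_w^0$ and $y_{u,w}^*=x_u^*=-x_w^*$. A solution exists, and the value $y^*_{u,w}$ is the same for all solutions. Effective resistance. If there is a directed path from $u$ to $w$ in $G$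 ($u\ne w$), then $\mu_{u,w}$ is the unique positive real number such that $y_{u,w}^*=y_{u,w}^r/\mu_{u,w}^s$ for all $y_{u,w}\ge 0$. If there is no directed path from $u$ to $w$, then $\mu_{u,w}=+\infty$. If $u=w$, then $\mu_{u,w}=0$. Conventions. $(+\infty)^{s/r}=+\infty$, $+\infty+t=+\infty$, and $+\infty=+\infty$ counts as equality. Directed paths have no repeated nodes; the only directed path from a node to itself is the trivial one consisting of that node. *)

theory Defs
  imports "HOL-Analysis.Analysis" "Graph_Theory.Arc_Walk"
begin

text \<open>
  Circuits live on directed multigraphs of type \<^typ>\<open>('a, 'b) pre_digraph\<close>; parallel arcs and
  loops are allowed (a loop has voltage 0 and hence carries no current). Potential vectors are total
  functions on the node type, but only their values on the nodes of the graph matter.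
\<close>

definition voltage :: "('a, 'b) pre_digraph \<Rightarrow> ('a \<Rightarrow> real) \<Rightarrow> 'b \<Rightarrow> real" where
  "voltage G x e = x (tail G e) - x (head G e)"

definition current ::
  "('a, 'b) pre_digraph \<Rightarrow> ('b \<Rightarrow> real) \<Rightarrow> real \<Rightarrow> real \<Rightarrow> ('a \<Rightarrow> real) \<Rightarrow> 'b \<Rightarrow> real" where
  "current G \<mu> r s x e =
     (if voltage G x e \<ge> 0 then voltage G x e powr r / \<mu> e powr s else 0)"

definition flux ::
  "('a, 'b) pre_digraph \<Rightarrow> ('b \<Rightarrow> real) \<Rightarrow> real \<Rightarrow> real \<Rightarrow> ('a \<Rightarrow> real) \<Rightarrow> 'a \<Rightarrow> real" where
  "flux G \<mu> r s x v =
     (\<Sum>e\<in>out_arcs G v. current G \<mu> r s x e) - (\<Sum>e\<in>in_arcs G v. current G \<mu> r s x e)"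

definition is_solution ::
  "('a, 'b) pre_digraph \<Rightarrow> ('b \<Rightarrow> real) \<Rightarrow> real \<Rightarrow> real \<Rightarrow> 'a \<Rightarrow> 'a \<Rightarrow> real \<Rightarrow> real \<Rightarrow> ('a \<Rightarrow> real) \<Rightarrow> bool"
  where
  "is_solution G \<mu> r s u w xu xw x \<longleftrightarrow>
     x u = xu \<and> x w = xw \<and> (\<forall>v\<in>verts G - {u, w}. flux G \<mu> r s x v = 0)"

text \<open>
  The current between the poles is the flux at \<open>u\<close> of a solution. Its independence of the solution
  is expressed by demanding the power law for all solutions; since solutions exist for all boundary
  values \<open>xu \<ge> xw\<close>, the condition below pins down \<open>m\<close> when \<open>w\<close> is reachable from \<open>u\<close>.
\<close>

definition effective_resistance ::
  "('a, 'b) pre_digraph \<Rightarrow> ('b \<Rightarrow> real) \<Rightarrow> real \<Rightarrow> real \<Rightarrow> 'a \<Rightarrow> 'a \<Rightarrow> ennreal" where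
  "effective_resistance G \<mu> r s u w =
     (if u = w then 0
      else if \<exists>p. pre_digraph.apath G u p w then
        ennreal (THE m. m > 0 \<and>
          (\<forall>xu xw x. xu \<ge> xw \<longrightarrow> is_solution G \<mu> r s u w xu xw x \<longrightarrow>
             flux G \<mu> r s x u = (xu - xw) powr r / m powr s))
      else \<infinity>)"

text \<open>Powers of extended nonnegative reals, intended for positive exponents only.\<close>

definition ennreal_powr :: "ennreal \<Rightarrow> real \<Rightarrow> ennreal" where
  "ennreal_powr z p = (if z = \<infinity> then \<infinity> else ennreal (enn2real z powr p))"

end

theory Submission
  imports Defs
begin

text \<open>
  The quantity \<open>\<mu>\<^bsub>u,v\<^esub>\<^bsup>s/r\<^esup>\<close> is the voltage that drives a unit current from \<open>u\<close> to \<open>v\<close>. For two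
  potentials \<open>x\<close> and \<open>z\<close>, every arc leaving a superlevel set of \<open>z - x\<close> carries at least as much
  current under \<open>z\<close> as under \<open>x\<close>, and every arc entering it at most as much. Comparing the unit flow
  from \<open>a\<close> to \<open>b\<close> with the unit flows from \<open>a\<close> to \<open>c\<close> and from \<open>c\<close> to \<open>b\<close> in this way bounds the
  voltages from \<open>a\<close> to \<open>c\<close> and from \<open>c\<close> to \<open>b\<close> of the former, and their sum is the voltage from
  \<open>a\<close> to \<open>b\<close>. If \<open>c\<close> separates \<open>a\<close> from \<open>b\<close>, the two shorter flows can be pasted together at \<open>c\<close>.
  Conversely, equality makes all current of the flow from \<open>a\<close> to \<open>b\<close> pass through \<open>c\<close>, whereas a
  path avoiding \<open>c\<close> would cross the level \<open>x c\<close> along an arc with positive current.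
\<close>

lemma powr_left_inj_nonneg:
  fixes x y p :: real
  assumes "x \<ge> 0" "y \<ge> 0" "p > 0"
  shows "x powr p = y powr p \<longleftrightarrow> x = y"
  using assms powr_less_mono2[of p x y] powr_less_mono2[of p y x]
  by (cases x y rule: linorder_cases) auto

locale circuit = fin_digraph G for G :: "('a, 'b) pre_digraph" +
  fixes \<mu> :: "'b \<Rightarrow> real" and r s :: real
  assumes resistance_pos: "\<And>e. e \<in> arcs G \<Longrightarrow> \<mu> e > 0"
    and r_pos: "r > 0" and s_pos: "s > 0"
begin

abbreviation "cur \<equiv> current G \<mu> r s"
abbreviation "flx \<equiv> flux G \<mu> r s"
abbreviation "volt \<equiv> voltage G"

subsection \<open>Currents and fluxes\<close>

lemma current_conv_max: "cur x e = max 0 (volt x e) powr r / \<mu> e powr s"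
  using r_pos by (auto simp: current_def max_def)

lemma current_nonneg: "cur x e \<ge> 0"
  by (simp add: current_conv_max)

lemma current_mono: "volt x e \<le> volt y e \<Longrightarrow> cur x e \<le> cur y e"
  unfolding current_conv_max using r_pos
  by (intro divide_right_mono powr_mono2) (auto simp: max_def)

lemma current_pos_iff: "e \<in> arcs G \<Longrightarrow> cur x e > 0 \<longleftrightarrow> volt x e > 0"
  using resistance_pos[of e] r_pos
  by (cases "volt x e = 0") (auto simp: current_conv_max max_def zero_less_divide_iff)

lemma current_zero_iff: "e \<in> arcs G \<Longrightarrow> cur x e = 0 \<longleftrightarrow> volt x e \<le> 0"
  using current_pos_iff[of e x] current_nonneg[of x e] by linarith

lemma current_cong: "volt x e = volt y e \<Longrightarrow> cur x e = cur y e"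
  by (simp add: current_conv_max)

lemma current_inj:
  assumes "e \<in> arcs G" "cur x e = cur y e" "cur x e > 0"
  shows "volt x e = volt y e"
proof -
  have "volt x e > 0" "volt y e > 0"
    using assms current_pos_iff[OF assms(1)] by metis+
  moreover have "volt x e powr r = volt y e powr r"
    using assms calculation resistance_pos[of e] by (simp add: current_conv_max)
  ultimately show ?thesis
    using r_pos by (simp add: powr_left_inj_nonneg)
qed

lemma current_affine:
  assumes "k \<ge> 0"
  shows "cur (\<lambda>v. t + k * x v) e = k powr r * cur x e"
proof -
  have "volt (\<lambda>v. t + k * x v) e = k * volt x e"
    by (simp add: voltage_def algebra_simps)
  moreover have "max 0 (k * volt x e) = k * max 0 (volt x e)"
    using assms by (auto simp: max_def mult_le_0_iff zero_le_mult_iff)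
  ultimately show ?thesis
    using assms by (simp add: current_conv_max powr_mult)
qed

text \<open>Homogeneity of degree \<open>r\<close> is the source of the power law: one solution for
  voltage 1 rescales to a solution for every other voltage.\<close>

lemma flux_affine:
  assumes "k \<ge> 0"
  shows "flx (\<lambda>v. t + k * x v) v = k powr r * flx x v"
  by (simp add: flux_def current_affine[OF assms] sum_distrib_left right_diff_distrib)

text \<open>No arc leaving \<open>v\<close> loses voltage and no arc entering \<open>v\<close> gains
  any; loops stay at voltage 0. This is the comparison principle behind Perron's method.\<close>

lemma flux_mono:
  assumes "v \<in> verts G" "x v \<le> y v" "\<And>w. w \<in> verts G \<Longrightarrow> w \<noteq> v \<Longrightarrow> y w \<le> x w"
  shows "flx x v \<le> flx y v"
proof -
  have "cur x e \<le> cur y e" if "e \<in> out_arcs G v" for e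
    using that assms wellformed by (intro current_mono) (cases "head G e = v"; force simp: voltage_def)
  moreover have "cur y e \<le> cur x e" if "e \<in> in_arcs G v" for e
    using that assms wellformed by (intro current_mono) (cases "tail G e = v"; force simp: voltage_def)
  ultimately show ?thesis
    unfolding flux_def by (intro diff_mono sum_mono) auto
qed

lemma isCont_flux_upd: "isCont (\<lambda>t. flx (x(v := t)) w) t"
proof -
  have "isCont (\<lambda>t. volt (x(v := t)) e) t" for e
    by (cases "tail G e = v"; cases "head G e = v") (simp_all add: voltage_def)
  hence "isCont (\<lambda>t. max 0 (volt (x(v := t)) e)) t" for e
    by (intro continuous_max continuous_const)
  hence "isCont (\<lambda>t. cur (x(v := t)) e) t" for e
    unfolding current_conv_max isCont_def divide_inverse using r_pos
    by (intro tendsto_mult tendsto_powr' tendsto_const) auto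
  thus ?thesis
    unfolding flux_def by (intro continuous_diff continuous_sum) auto
qed

section \<open>Summation by parts and comparison across cuts\<close>

text \<open>Summation by parts. Indicator weights yield cut formulas, the potential itself yields
  the energy, and a difference of potentials yields uniqueness.\<close>

lemma sum_weighted_flux:
  "(\<Sum>v\<in>verts G. \<phi> v * flx x v) = (\<Sum>e\<in>arcs G. (\<phi> (tail G e) - \<phi> (head G e)) * cur x e)"
proof -
  have "(\<Sum>v\<in>verts G. \<phi> v * (\<Sum>e\<in>out_arcs G v. cur x e)) = 
      (\<Sum>v\<in>verts G. \<Sum>e\<in>{e \<in> arcs G. tail G e = v}. \<phi> (tail G e) * cur x e)"
    unfolding sum_distrib_left out_arcs_def by (intro sum.cong) auto
  also have "\<dots> = (\<Sum>e\<in>arcs G. \<phi> (tail G e) * cur x e)"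
    by (rule sum.group) auto
  finally have out: "(\<Sum>v\<in>verts G. \<phi> v * (\<Sum>e\<in>out_arcs G v. cur x e)) = \<dots>" .
  have "(\<Sum>v\<in>verts G. \<phi> v * (\<Sum>e\<in>in_arcs G v. cur x e)) = 
      (\<Sum>v\<in>verts G. \<Sum>e\<in>{e \<in> arcs G. head G e = v}. \<phi> (head G e) * cur x e)"
    unfolding sum_distrib_left in_arcs_def by (intro sum.cong) auto
  also have "\<dots> = (\<Sum>e\<in>arcs G. \<phi> (head G e) * cur x e)"
    by (rule sum.group) auto
  finally have "(\<Sum>v\<in>verts G. \<phi> v * (\<Sum>e\<in>in_arcs G v. cur x e)) = \<dots>" .
  with out show ?thesis
    by (simp add: flux_def right_diff_distrib left_diff_distrib sum_subtractf)
qed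

lemma sum_flux_cut:
  assumes "S \<subseteq> verts G"
  shows "(\<Sum>v\<in>S. flx x v) = 
    (\<Sum>e\<in>arcs G. (of_bool (tail G e \<in> S) - of_bool (head G e \<in> S)) * cur x e)"
proof -
  have "(\<Sum>v\<in>S. flx x v) = (\<Sum>v\<in>verts G. of_bool (v \<in> S) * flx x v)"
    using assms by (intro sum.mono_neutral_cong_left) auto
  thus ?thesis by (simp only: sum_weighted_flux)
qed

lemma sum_flux_verts: "(\<Sum>v\<in>verts G. flx x v) = 0"
  using sum_flux_cut[of "verts G" x] by simp

text \<open>Arcs that do not cross the boundary of \<open>S\<close> cancel from the flux sums. What
  remains is a termwise inequality, and equal sums force equal terms.\<close>

lemma cut_compare:
  assumes S: "S \<subseteq> verts G"
    and out: "\<And>e. e \<in> arcs G \<Longrightarrow> tail G e \<in> S \<Longrightarrow> head G e \<notin> S \<Longrightarrow> cur x e \<le> cur z e"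
    and into: "\<And>e. e \<in> arcs G \<Longrightarrow> tail G e \<notin> S \<Longrightarrow> head G e \<in> S \<Longrightarrow> cur z e \<le> cur x e"
  shows "(\<Sum>v\<in>S. flx x v) \<le> (\<Sum>v\<in>S. flx z v)"
    and "(\<Sum>v\<in>S. flx x v) = (\<Sum>v\<in>S. flx z v) \<Longrightarrow> e \<in> arcs G \<Longrightarrow>
      (tail G e \<in> S) \<noteq> (head G e \<in> S) \<Longrightarrow> cur x e = cur z e"
proof -
  let ?g = "\<lambda>x e. (of_bool (tail G e \<in> S) - of_bool (head G e \<in> S)) * cur x e"
  have le: "?g x e \<le> ?g z e" if "e \<in> arcs G" for e
    using out[OF that] into[OF that] by auto
  show "(\<Sum>v\<in>S. flx x v) \<le> (\<Sum>v\<in>S. flx z v)"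
    unfolding sum_flux_cut[OF S] by (intro sum_mono le)
  assume "(\<Sum>v\<in>S. flx x v) = (\<Sum>v\<in>S. flx z v)" and e: "e \<in> arcs G"
    and cross: "(tail G e \<in> S) \<noteq> (head G e \<in> S)"
  hence "?g x e = ?g z e"
    unfolding sum_flux_cut[OF S] using le
    by (intro sum_mono_inv[of "?g x" "arcs G" "?g z"]) auto
  with cross show "cur x e = cur z e" by (auto simp: of_bool_def split: if_splits)
qed

text \<open>Compare \<open>x\<close> with a constant potential, which carries no current: when the
  net flow across a cut is 0, no current one way means none the other way.\<close>

lemma cut_balance:
  assumes S: "S \<subseteq> verts G" and "(\<Sum>v\<in>S. flx x v) = 0"
  shows "(\<forall>e\<in>arcs G. tail G e \<in> S \<longrightarrow> head G e \<notin> S \<longrightarrow> cur x e = 0) \<longleftrightarrow>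
    (\<forall>e\<in>arcs G. tail G e \<notin> S \<longrightarrow> head G e \<in> S \<longrightarrow> cur x e = 0)" (is "?out \<longleftrightarrow> ?into")
proof -
  have const: "cur (\<lambda>_. 0) e = 0" for e
    using r_pos by (simp add: current_conv_max voltage_def)
  hence "flx (\<lambda>_. 0) v = 0" for v
    by (simp add: flux_def)
  hence sum: "(\<Sum>v\<in>S. flx x v) = (\<Sum>v\<in>S. flx (\<lambda>_. 0) v)"
    using assms by simp
  show ?thesis
  proof
    assume "?out"
    thus "?into"
      using cut_compare(2)[OF S, of x "\<lambda>_. 0"] sum const current_nonneg by auto
  next
    assume "?into"
    thus "?out"
      using cut_compare(2)[OF S, of "\<lambda>_. 0" x] sum const current_nonneg by auto
  qed
qed

lemma flux_mult_diff_nonneg: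
  assumes "e \<in> arcs G"
  shows "(volt x e - volt z e) * (cur x e - cur z e) \<ge> 0"
    and "(volt x e - volt z e) * (cur x e - cur z e) = 0 \<Longrightarrow> cur x e = cur z e"
proof -
  show "(volt x e - volt z e) * (cur x e - cur z e) \<ge> 0"
    using current_mono[of x e z] current_mono[of z e x]
    by (cases "volt x e \<le> volt z e") (auto simp: mult_nonpos_nonpos)
  show "(volt x e - volt z e) * (cur x e - cur z e) = 0 \<Longrightarrow> cur x e = cur z e"
    using current_cong[of x e z] by auto
qed

text \<open>On arcs crossing the boundary of \<open>S\<close> the voltage inequality is strict.
  Equal sums make the currents there agree, which under strictness is possible only if they
  vanish.\<close>

lemma superlevel_compare:
  fixes x z t
  defines "S \<equiv> {v \<in> verts G. z v - x v \<ge> t}"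
  shows "(\<Sum>v\<in>S. flx x v) \<le> (\<Sum>v\<in>S. flx z v)"
    and "(\<Sum>v\<in>S. flx x v) = (\<Sum>v\<in>S. flx z v) \<Longrightarrow> (\<Sum>v\<in>S. flx x v) = 0"
proof -
  have S: "S \<subseteq> verts G" by (auto simp: S_def)
  have out: "volt x e < volt z e" if "e \<in> arcs G" "tail G e \<in> S" "head G e \<notin> S" for e
    using that wellformed by (auto simp: S_def voltage_def)
  have into: "volt z e < volt x e" if "e \<in> arcs G" "tail G e \<notin> S" "head G e \<in> S" for e
    using that wellformed by (auto simp: S_def voltage_def)
  have out': "cur x e \<le> cur z e" if "e \<in> arcs G" "tail G e \<in> S" "head G e \<notin> S" for e
    using out[OF that] by (intro current_mono) auto
  have into': "cur z e \<le> cur x e" if "e \<in> arcs G" "tail G e \<notin> S" "head G e \<in> S" for e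
    using into[OF that] by (intro current_mono) auto
  note cmp = cut_compare[OF S, of x z, OF out' into']
  show "(\<Sum>v\<in>S. flx x v) \<le> (\<Sum>v\<in>S. flx z v)"
    by (rule cmp)
  assume eq: "(\<Sum>v\<in>S. flx x v) = (\<Sum>v\<in>S. flx z v)"
  have "cur x e = 0" if "e \<in> arcs G" "(tail G e \<in> S) \<noteq> (head G e \<in> S)" for e
  proof (rule ccontr)
    assume "cur x e \<noteq> 0"
    hence "volt x e = volt z e"
      using cmp(2)[OF _ _ _ _ _ _ eq that] that(1) current_nonneg[of x e] current_inj[of e x z] by auto
    thus False using out[of e] into[of e] that by auto
  qed
  thus "(\<Sum>v\<in>S. flx x v) = 0"
    unfolding sum_flux_cut[OF S] by (intro sum.neutral) auto
qed

subsection \<open>Existence and uniqueness\<close>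

text \<open>Perron's method: the pointwise supremum of all subsolutions is a solution.\<close>

lemma solution_exists:
  assumes u: "u \<in> verts G" and w: "w \<in> verts G" and "u \<noteq> w" and le: "xw \<le> xu"
  obtains x where "is_solution G \<mu> r s u w xu xw x" "\<And>v. xw \<le> x v" "\<And>v. x v \<le> xu"
proof -
  \<comment> \<open>Subsolutions: at every inner node inflow is at least outflow. The bounds by the
    pole values keep the supremum finite.\<close>
  define P where "P = {x. x u = xu \<and> x w = xw \<and> (\<forall>v. xw \<le> x v \<and> x v \<le> xu) \<and>
     (\<forall>v\<in>verts G - {u, w}. flx x v \<le> 0)}"
  define X where "X v = (SUP x\<in>P. x v)" for v
  let ?base = "\<lambda>v. if v = u then xu else xw"
  have "flx ?base v \<le> 0" if "v \<in> verts G - {u, w}" for v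
  proof -
    have "flx ?base v \<le> flx (\<lambda>_. xw) v"
      using that le by (intro flux_mono) auto
    also have "\<dots> = 0"
      using r_pos by (simp add: flux_def current_conv_max voltage_def)
    finally show ?thesis .
  qed
  hence base: "?base \<in> P"
    using assms by (auto simp: P_def)
  have bdd: "bdd_above ((\<lambda>x. x v) ` P)" for v
    by (rule bdd_aboveI[of _ xu]) (auto simp: P_def)
  have X_upper: "x v \<le> X v" if "x \<in> P" for x v
    unfolding X_def using bdd that by (intro cSUP_upper) auto
  have X_le: "X v \<le> B" if "\<And>x. x \<in> P \<Longrightarrow> x v \<le> B" for v B
    unfolding X_def using base that by (intro cSUP_least) auto
  have X_less: "\<exists>x\<in>P. t < x v" if "t < X v" for t v
    using X_le[of v t] that by force
  have Xu: "X u = xu"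
    using X_upper[OF base, of u] X_le[of u xu] by (auto simp: P_def)
  have Xw: "X w = xw"
    using X_upper[OF base, of w] X_le[of w xw] \<open>u \<noteq> w\<close> by (auto simp: P_def)
  have X_ge: "xw \<le> X v" for v
    using X_upper[OF base, of v] le by (auto split: if_splits)
  have X_le_xu: "X v \<le> xu" for v
    using X_le[of v xu] by (auto simp: P_def)
  \<comment> \<open>By continuity a positive flux would survive lowering \<open>X v\<close> to a
    close \<open>z v\<close> with \<open>z\<close> in \<open>P\<close>; lowering the other nodes to
    \<open>z\<close> as well cannot decrease it.\<close>
  have sub: "flx X v \<le> 0" if v: "v \<in> verts G - {u, w}" for v
  proof (rule ccontr)
    assume "\<not> flx X v \<le> 0"
    hence "flx (X(v := X v)) v > 0" by simp
    from order_tendstoD(1)[OF isCont_flux_upd[unfolded isCont_def] this]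
    obtain d where d: "d > 0" "\<And>t. t \<noteq> X v \<Longrightarrow> \<bar>t - X v\<bar> < d \<Longrightarrow> flx (X(v := t)) v > 0"
      by (auto simp: eventually_at dist_real_def)
    obtain z where z: "z \<in> P" "X v - d < z v"
      using X_less[of "X v - d" v] d by auto
    have "flx (X(v := z v)) v > 0"
      using d(2)[of "z v"] z X_upper[OF z(1), of v] \<open>\<not> flx X v \<le> 0\<close>
      by (cases "z v = X v") auto
    moreover have "flx (X(v := z v)) v \<le> flx z v"
      using v X_upper[OF z(1)] by (intro flux_mono) auto
    ultimately show False
      using z(1) v by (force simp: P_def)
  qed
  \<comment> \<open>At the ceiling \<open>xu\<close> no arc brings current into \<open>v\<close>.
    Below it, a negative flux would leave room to raise \<open>X\<close> at \<open>v\<close> without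
    leaving \<open>P\<close>.\<close>
  have super: "flx X v \<ge> 0" if v: "v \<in> verts G - {u, w}" for v
  proof (cases "X v = xu")
    case True
    have "cur X e = 0" if "e \<in> in_arcs G v" for e
      using that True X_le_xu[of "tail G e"] by (subst current_zero_iff) (auto simp: voltage_def)
    thus ?thesis
      unfolding flux_def using current_nonneg by (simp add: sum_nonneg)
  next
    case False
    show ?thesis
    proof (rule ccontr)
      assume neg: "\<not> flx X v \<ge> 0"
      hence "flx (X(v := X v)) v < 0" by simp
      from order_tendstoD(2)[OF isCont_flux_upd[unfolded isCont_def] this]
      obtain d where d: "d > 0" "\<And>t. t \<noteq> X v \<Longrightarrow> \<bar>t - X v\<bar> < d \<Longrightarrow> flx (X(v := t)) v < 0"
        by (auto simp: eventually_at dist_real_def)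
      \<comment> \<open>Capped at \<open>xu\<close> to respect the bound in \<open>P\<close>.
        Raising \<open>v\<close> cannot increase the flux at other nodes.\<close>
      define t where "t = min xu (X v + d / 2)"
      have t: "X v < t" "t \<le> xu" "\<bar>t - X v\<bar> < d"
        using d(1) False X_le_xu[of v] by (auto simp: t_def min_def)
      have "flx (X(v := t)) v' \<le> 0" if v': "v' \<in> verts G - {u, w}" for v'
      proof (cases "v' = v")
        case True
        thus ?thesis using d(2)[of t] t by force
      next
        case False
        hence "flx (X(v := t)) v' \<le> flx X v'"
          using v' t by (intro flux_mono) auto
        with sub[OF v'] show ?thesis by simp
      qed
      hence "X(v := t) \<in> P"
        unfolding P_def using t v Xu Xw X_ge X_le_xu order_trans[OF X_ge[of v] less_imp_le[OF t(1)]]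
        by auto
      from X_upper[OF this, of v] t show False by simp
    qed
  qed
  have "is_solution G \<mu> r s u w xu xw X"
    unfolding is_solution_def using Xu Xw sub super by (auto intro: antisym)
  thus thesis using that X_ge X_le_xu by blast
qed

section \<open>Uniqueness and positivity of the current between the poles\<close>

lemma sum_solution:
  assumes "is_solution G \<mu> r s u w xu xw x" "u \<noteq> w" "S \<subseteq> verts G"
  shows "(\<Sum>v\<in>S. \<phi> v * flx x v) = of_bool (u \<in> S) * \<phi> u * flx x u + of_bool (w \<in> S) * \<phi> w * flx x w"
proof -
  have "finite S" using assms(3) finite_subset finite_verts by blast
  have "(\<Sum>v\<in>S. \<phi> v * flx x v) = (\<Sum>v\<in>S \<inter> {u, w}. \<phi> v * flx x v)"
    using assms \<open>finite S\<close> by (intro sum.mono_neutral_right) (auto simp: is_solution_def)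
  thus ?thesis
    using \<open>u \<noteq> w\<close> by (cases "u \<in> S"; cases "w \<in> S") auto
qed

lemma solution_flux_sink:
  assumes "is_solution G \<mu> r s u w xu xw x" "u \<noteq> w" "u \<in> verts G" "w \<in> verts G"
  shows "flx x w = - flx x u"
  using sum_solution[OF assms(1,2) subset_refl, of "\<lambda>_. 1"] sum_flux_verts[of x] assms by simp

text \<open>Energy argument: the difference of the potentials vanishes at the poles, so the products
  of voltage difference and current difference sum to 0. They are nonnegative by monotonicity, hence
  all currents agree, even where the potentials do not.\<close>

lemma solution_flux_unique:
  assumes x: "is_solution G \<mu> r s u w xu xw x" and z: "is_solution G \<mu> r s u w xu xw z"
    and uw: "u \<noteq> w" "u \<in> verts G" "w \<in> verts G"
  shows "flx x u = flx z u"
proof -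
  let ?d = "\<lambda>v. x v - z v"
  have d: "?d u = 0" "?d w = 0" using x z by (auto simp: is_solution_def)
  have "(\<Sum>e\<in>arcs G. (volt x e - volt z e) * (cur x e - cur z e)) =
     (\<Sum>v\<in>verts G. ?d v * flx x v) - (\<Sum>v\<in>verts G. ?d v * flx z v)"
    unfolding sum_weighted_flux sum_subtractf[symmetric]
    by (intro sum.cong) (auto simp: voltage_def algebra_simps)
  also have "\<dots> = 0"
    unfolding sum_solution[OF x uw(1) subset_refl, of ?d] sum_solution[OF z uw(1) subset_refl, of ?d]
    by (simp add: d)
  finally have "\<forall>e\<in>arcs G. cur x e = cur z e"
    using flux_mult_diff_nonneg by (subst (asm) sum_nonneg_eq_0_iff) auto
  thus ?thesis by (simp add: flux_def)
qed

lemma last_in_awalk_verts: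
  assumes "awalk u p v"
  shows "v \<in> set (awalk_verts u p)"
  using assms by (metis awalkE' awalk_verts_non_Nil last_in_set)

lemma awalk_leaves:
  assumes "awalk u p w" "u \<in> W" "w \<notin> W"
  obtains e where "e \<in> set p" "tail G e \<in> W" "head G e \<notin> W"
proof -
  have "\<exists>e\<in>set p. tail G e \<in> W \<and> head G e \<notin> W"
    using assms by (induction p arbitrary: u) (auto simp: awalk_simps)
  thus thesis using that by blast
qed

text \<open>The energy, the sum of voltage times current, equals pole voltage times pole current. It
  is positive because the walk descends from level \<open>xu\<close> along some arc.\<close>

lemma solution_flux_pos:
  assumes x: "is_solution G \<mu> r s u w xu xw x" and "xw < xu" and p: "awalk u p w"
  shows "flx x u > 0"
proof -
  have uw: "u \<noteq> w" "u \<in> verts G" "w \<in> verts G"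
    using x p \<open>xw < xu\<close> by (auto simp: is_solution_def)
  obtain e where e: "e \<in> set p" "x (tail G e) \<ge> xu" "x (head G e) < xu"
    using awalk_leaves[OF p, of "{v. x v \<ge> xu}"] x \<open>xw < xu\<close>
    by (auto simp: is_solution_def not_le)
  hence eG: "e \<in> arcs G" using p by auto
  have vpos: "volt x e > 0" using e by (simp add: voltage_def)
  have nonneg: "volt x e' * cur x e' \<ge> 0" if "e' \<in> arcs G" for e'
    using current_zero_iff[OF that, of x] current_nonneg[of x e']
    by (cases "volt x e' \<le> 0") auto
  have "0 < (\<Sum>e\<in>arcs G. volt x e * cur x e)"
    using eG vpos nonneg current_pos_iff[OF eG, of x] by (intro sum_pos2[of _ e]) auto
  also have "\<dots> = (\<Sum>v\<in>verts G. x v * flx x v)"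
    by (simp add: sum_weighted_flux voltage_def)
  also have "\<dots> = (xu - xw) * flx x u"
    unfolding sum_solution[OF x uw(1) subset_refl, of x]
    using x solution_flux_sink[OF x uw] uw by (auto simp: is_solution_def algebra_simps)
  finally show ?thesis using \<open>xw < xu\<close> by (simp add: zero_less_mult_iff)
qed

subsection \<open>Effective resistances\<close>

text \<open>Evaluates the definite description: uniqueness and homogeneity make the current a
  constant times the \<open>r\<close>-th power of the pole voltage, and the walk makes that constant
  positive.\<close>

lemma power_law_exists:
  assumes uw: "u \<noteq> w" "u \<in> verts G" "w \<in> verts G" and p: "awalk u p w"
  obtains m where "m > 0"
    "\<And>xu xw x. xu \<ge> xw \<Longrightarrow> is_solution G \<mu> r s u w xu xw x \<Longrightarrow>
       flx x u = (xu - xw) powr r / m powr s"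
    "effective_resistance G \<mu> r s u w = ennreal m"
proof -
  obtain x1 where x1: "is_solution G \<mu> r s u w 1 0 x1"
    using solution_exists[OF uw(2,3,1), of 0 1] by (metis zero_le_one)
  have pos: "flx x1 u > 0"
    using solution_flux_pos[OF x1 _ p] by simp
  define m where "m = flx x1 u powr (- 1 / s)"
  have "m powr s = flx x1 u powr - 1"
    unfolding m_def powr_powr using s_pos by simp
  hence m: "m > 0" "m powr s = 1 / flx x1 u"
    using pos by (simp_all add: m_def powr_minus_divide)
  have law: "flx x u = (xu - xw) powr r / m powr s"
    if "xu \<ge> xw" and x: "is_solution G \<mu> r s u w xu xw x" for xu xw x
  proof -
    have "is_solution G \<mu> r s u w xu xw (\<lambda>v. xw + (xu - xw) * x1 v)"
      using x1 that(1) by (auto simp: is_solution_def flux_affine)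
    from solution_flux_unique[OF x this uw] show ?thesis
      using that(1) by (simp add: flux_affine m)
  qed
  have "(THE m. m > 0 \<and> (\<forall>xu xw x. xu \<ge> xw \<longrightarrow> is_solution G \<mu> r s u w xu xw x \<longrightarrow>
           flx x u = (xu - xw) powr r / m powr s)) = m"
  proof (rule the_equality)
    fix m' assume m': "m' > 0 \<and> (\<forall>xu xw x. xu \<ge> xw \<longrightarrow> is_solution G \<mu> r s u w xu xw x \<longrightarrow>
           flx x u = (xu - xw) powr r / m' powr s)"
    hence "flx x1 u = (1 - 0) powr r / m' powr s"
      using x1 by (metis zero_le_one)
    hence "m' powr s = m powr s"
      by (simp add: m)
    thus "m' = m"
      using m' m(1) s_pos by (simp add: powr_left_inj_nonneg)
  qed (use m law in blast)
  moreover have "\<exists>p. apath u p w"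
    using p reachable_awalk reachable_apath by blast
  ultimately have "effective_resistance G \<mu> r s u w = ennreal m"
    using uw by (simp add: effective_resistance_def)
  thus thesis using that m(1) law by blast
qed

text \<open>In this form the triangle inequality compares voltages of unit flows, with no powers
  left.\<close>

lemma unit_voltage_exists:
  assumes uw: "u \<noteq> w" "u \<in> verts G" "w \<in> verts G" and p: "awalk u p w"
  obtains R where "R > 0"
    "ennreal_powr (effective_resistance G \<mu> r s u w) (s / r) = ennreal R"
    "\<And>x xu xw. xu \<ge> xw \<Longrightarrow> is_solution G \<mu> r s u w xu xw x \<Longrightarrow> flx x u = 1 \<longleftrightarrow> xu - xw = R"
proof -
  obtain m where m: "m > 0" "effective_resistance G \<mu> r s u w = ennreal m"
    "\<And>xu xw x. xu \<ge> xw \<Longrightarrow> is_solution G \<mu> r s u w xu xw x \<Longrightarrow>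
       flx x u = (xu - xw) powr r / m powr s"
    using power_law_exists[OF assms] by metis
  define R where "R = m powr (s / r)"
  have R: "R > 0" "m powr s = R powr r"
    using m r_pos by (simp_all add: R_def powr_powr)
  have "flx x u = 1 \<longleftrightarrow> xu - xw = R" if "xu \<ge> xw" "is_solution G \<mu> r s u w xu xw x" for x xu xw
  proof -
    have "flx x u = 1 \<longleftrightarrow> (xu - xw) powr r = R powr r"
      using R m(3)[OF that] by auto
    also have "\<dots> \<longleftrightarrow> xu - xw = R"
      using that(1) R(1) r_pos by (intro powr_left_inj_nonneg) auto
    finally show ?thesis .
  qed
  moreover have "ennreal_powr (effective_resistance G \<mu> r s u w) (s / r) = ennreal R"
    using m(1) by (simp add: m(2) ennreal_powr_def R_def)
  ultimately show thesis using that R(1) by blast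
qed

lemma effective_resistance_infinite:
  assumes "u \<noteq> w" "\<nexists>p. awalk u p w"
  shows "ennreal_powr (effective_resistance G \<mu> r s u w) p = \<infinity>"
proof -
  have "\<nexists>p. apath u p w" using assms(2) awalkI_apath by blast
  thus ?thesis using assms(1) by (simp add: effective_resistance_def ennreal_powr_def)
qed

lemma ennreal_powr_effective_resistance_self:
  "ennreal_powr (effective_resistance G \<mu> r s u u) p = 0"
  by (simp add: effective_resistance_def ennreal_powr_def)

subsection \<open>Three nodes\<close>

text \<open>Otherwise the superlevel set \<open>S\<close> of \<open>z - x\<close> at its value in
  \<open>c\<close> contains \<open>c\<close> but not \<open>a\<close>. Its flux is -1 under
  \<open>z\<close> and 0 or -1 under \<open>x\<close>; comparison leaves only equality at -1, but
  equality forces 0.\<close>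

lemma unit_flow_voltage_le_source:
  assumes abc: "a \<in> verts G" "b \<in> verts G" "c \<in> verts G" "a \<noteq> b" "a \<noteq> c" "b \<noteq> c"
    and x: "is_solution G \<mu> r s a b xa xb x" "flx x a = 1"
    and z: "is_solution G \<mu> r s a c za zc z" "flx z a = 1"
  shows "x a - x c \<le> z a - z c"
proof (rule ccontr)
  assume less: "\<not> ?thesis"
  define S where "S = {v \<in> verts G. z v - x v \<ge> z c - x c}"
  have S: "S \<subseteq> verts G" "a \<notin> S" "c \<in> S"
    using less abc by (auto simp: S_def)
  have "flx x b = - 1" "flx z c = - 1"
    using solution_flux_sink[OF x(1)] solution_flux_sink[OF z(1)] x(2) z(2) abc by auto
  hence "(\<Sum>v\<in>S. flx x v) = - of_bool (b \<in> S)" "(\<Sum>v\<in>S. flx z v) = - 1"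
    using sum_solution[OF x(1) abc(4) S(1), of "\<lambda>_. 1"]
      sum_solution[OF z(1) abc(5) S(1), of "\<lambda>_. 1"] S x(2) z(2) by auto
  with superlevel_compare[where x = x and z = z and t = "z c - x c"] show False
    by (auto simp: S_def[symmetric] of_bool_def split: if_splits)
qed

text \<open>Mirror image at the sink: with the level taken at \<open>b\<close>, the set
  \<open>S\<close> contains \<open>b\<close> but not \<open>c\<close>, and the same contradiction
  arises.\<close>

lemma unit_flow_voltage_le_sink:
  assumes abc: "a \<in> verts G" "b \<in> verts G" "c \<in> verts G" "a \<noteq> b" "a \<noteq> c" "b \<noteq> c"
    and x: "is_solution G \<mu> r s a b xa xb x" "flx x a = 1"
    and z: "is_solution G \<mu> r s c b zc zb z" "flx z c = 1"
  shows "x c - x b \<le> z c - z b"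
proof (rule ccontr)
  assume less: "\<not> ?thesis"
  define S where "S = {v \<in> verts G. z v - x v \<ge> z b - x b}"
  have S: "S \<subseteq> verts G" "b \<in> S" "c \<notin> S"
    using less abc by (auto simp: S_def)
  have "flx x b = - 1" "flx z b = - 1"
    using solution_flux_sink[OF x(1)] solution_flux_sink[OF z(1)] x(2) z(2) abc by auto
  hence "(\<Sum>v\<in>S. flx x v) = of_bool (a \<in> S) - 1" "(\<Sum>v\<in>S. flx z v) = - 1"
    using sum_solution[OF x(1) abc(4) S(1), of "\<lambda>_. 1"]
      sum_solution[OF z(1) abc(6)[symmetric] S(1), of "\<lambda>_. 1"] S x(2) z(2) by auto
  with superlevel_compare[where x = x and z = z and t = "z b - x b"] show False
    by (auto simp: S_def[symmetric] of_bool_def split: if_splits)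
qed

text \<open>
  If all arcs leaving \<open>A\<close> enter \<open>c\<close>, then in both circuits no current flows from the rest of the
  graph into \<open>A\<close>, so the two flows can be pasted together along \<open>c\<close>.
\<close>

lemma glue_solutions:
  assumes A: "A \<subseteq> verts G" "a \<in> A" "b \<notin> A" "c \<notin> A"
    "\<And>e. e \<in> arcs G \<Longrightarrow> tail G e \<in> A \<Longrightarrow> head G e \<notin> A \<Longrightarrow> head G e = c"
    and bc: "b \<in> verts G" "c \<in> verts G" "b \<noteq> c"
    and z: "is_solution G \<mu> r s a c za t z" "\<And>v. t \<le> z v" "flx z a = 1"
    and y: "is_solution G \<mu> r s c b t yb y" "\<And>v. y v \<le> t" "flx y c = 1"
  defines "x \<equiv> \<lambda>v. if v \<in> A then z v else y v"
  shows "is_solution G \<mu> r s a b za yb x" "flx x a = 1"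
proof -
  \<comment> \<open>The side of \<open>b\<close>. An arc entering \<open>U\<close> must start at
    \<open>c\<close>, where \<open>z\<close> is lowest, so \<open>z\<close> sends no current into
    \<open>U\<close> and hence none out of it.\<close>
  define U where "U = verts G - A - {c}"
  have zc: "z c = t" and yc: "y c = t" using z(1) y(1) by (auto simp: is_solution_def)
  have "(\<Sum>v\<in>U. flx z v) = 0"
    using z(1) A by (intro sum.neutral) (auto simp: U_def is_solution_def)
  moreover have "cur z e = 0" if "e \<in> arcs G" "tail G e \<notin> U" "head G e \<in> U" for e
  proof -
    have "tail G e = c" using that A(5)[of e] wellformed(1)[of e] by (auto simp: U_def)
    thus ?thesis using that(1) z(2)[of "head G e"] zc by (simp add: current_zero_iff voltage_def)
  qed
  ultimately have zU: "cur z e = 0" if "e \<in> arcs G" "tail G e \<in> U" "head G e \<notin> U" for e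
    using cut_balance[of U z] that by (auto simp: U_def)
  \<comment> \<open>Dually, arcs leaving \<open>A\<close> end at \<open>c\<close>, where
    \<open>y\<close> is highest, so \<open>y\<close> has no current across the boundary of
    \<open>A\<close>.\<close>
  have "(\<Sum>v\<in>A. flx y v) = 0"
    using y(1) A by (intro sum.neutral) (auto simp: is_solution_def)
  moreover have "cur y e = 0" if "e \<in> arcs G" "tail G e \<in> A" "head G e \<notin> A" for e
    using that A(5)[OF that] y(2)[of "tail G e"] yc by (simp add: current_zero_iff voltage_def)
  ultimately have yA: "cur y e = 0" if "e \<in> arcs G" "tail G e \<notin> A" "head G e \<in> A" for e
    using cut_balance[of A y] that A(1) by auto
  have into_A: "cur x e = 0" if "e \<in> arcs G" "tail G e \<notin> A" "head G e \<in> A" for e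
    using that z(2)[of "head G e"] y(2)[of "tail G e"]
    by (simp add: current_zero_iff voltage_def x_def)
  have x_A: "cur x e = cur z e" if e: "e \<in> arcs G" "tail G e \<in> A \<or> head G e \<in> A" for e
  proof (cases "tail G e \<in> A")
    case True
    thus ?thesis
      using A(5)[OF e(1)] zc yc by (intro current_cong) (auto simp: voltage_def x_def)
  next
    case False
    hence h: "head G e \<in> A" using e by auto
    have "cur z e = 0"
    proof (cases "tail G e = c")
      case True
      thus ?thesis using e z(2)[of "head G e"] zc by (simp add: current_zero_iff voltage_def)
    next
      case False
      with \<open>tail G e \<notin> A\<close> h e show ?thesis by (intro zU) (auto simp: U_def)
    qed
    thus ?thesis using into_A[OF e(1) False h] by simp
  qed
  have x_U: "cur x e = cur y e" if e: "e \<in> arcs G" "tail G e \<in> U \<or> head G e \<in> U" for e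
  proof (cases "head G e \<in> A")
    case True
    hence "tail G e \<notin> A" using e by (auto simp: U_def)
    thus ?thesis using True e into_A yA by simp
  next
    case False
    hence "tail G e \<notin> A" using e A(5)[OF e(1)] by (auto simp: U_def)
    thus ?thesis using False by (intro current_cong) (auto simp: voltage_def x_def)
  qed
  have fA: "flx x v = flx z v" if "v \<in> A" for v
    unfolding flux_def using that x_A by (intro arg_cong2[of _ _ _ _ "(-)"] sum.cong) auto
  have fU: "flx x v = flx y v" if "v \<in> U" for v
    unfolding flux_def using that x_U by (intro arg_cong2[of _ _ _ _ "(-)"] sum.cong) auto
  show one: "flx x a = 1" using fA[OF A(2)] z(3) by simp
  have "flx y b = - 1"
    using solution_flux_sink[OF y(1)] bc y(3) by auto
  hence fb: "flx x b = - 1" using fU[of b] bc A by (auto simp: U_def)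
  have zero: "flx x v = 0" if "v \<in> verts G - {a, b, c}" for v
    using that fA[of v] fU[of v] z(1) y(1) A(4)
    by (cases "v \<in> A") (auto simp: U_def is_solution_def)
  have "0 = (\<Sum>v\<in>verts G. flx x v)" by (simp add: sum_flux_verts)
  also have "\<dots> = (\<Sum>v\<in>{a, b, c}. flx x v)"
    using zero A bc by (intro sum.mono_neutral_right) auto
  also have "\<dots> = flx x c"
    using A bc one fb by (subst sum.insert; force)
  finally have "flx x c = 0" by simp
  with zero have "\<forall>v\<in>verts G - {a, b}. flx x v = 0" by auto
  moreover have "x a = za" "x b = yb"
    using A z(1) y(1) by (auto simp: x_def is_solution_def)
  ultimately show "is_solution G \<mu> r s a b za yb x"
    by (simp add: is_solution_def)
qed

text \<open>
  Equal voltages from \<open>a\<close> to \<open>c\<close> force the two flows to agree on the arcs leaving the set \<open>D\<close> below,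
  so that the part of the flow \<open>x\<close> above level \<open>x c\<close> can only drain into \<open>c\<close>.
\<close>

lemma path_through_of_unit_flow_voltage_eq:
  assumes abc: "a \<in> verts G" "b \<in> verts G" "c \<in> verts G" "a \<noteq> b" "a \<noteq> c" "b \<noteq> c"
    and x: "is_solution G \<mu> r s a b xa xb x" "flx x a = 1"
    and z: "is_solution G \<mu> r s a c (x a) (x c) z" "flx z a = 1" "\<And>v. x c \<le> z v"
    and less: "x b \<le> x c" "x c < x a"
    and p: "awalk a p b"
  shows "c \<in> set (awalk_verts a p)"
proof (rule ccontr)
  assume nc: "c \<notin> set (awalk_verts a p)"
  \<comment> \<open>\<open>D\<close> and \<open>S\<close> split the nodes above level
    \<open>x c\<close> by whether \<open>z\<close> exceeds \<open>x\<close>. Outside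
    \<open>D\<close> always \<open>x \<le> z\<close>, below the level because \<open>z\<close> is at
    least \<open>x c\<close>.\<close>
  define D where "D = {v \<in> verts G. x v > x c \<and> z v \<le> x v}"
  define S where "S = {v \<in> verts G. x v > x c \<and> z v > x v}"
  have za: "z a = x a" and zc: "z c = x c" using z(1) by (auto simp: is_solution_def)
  have D: "D \<subseteq> verts G" "a \<in> D" "b \<notin> D" "c \<notin> D"
    using less abc za by (auto simp: D_def)
  have S: "S \<subseteq> verts G" "a \<notin> S" "b \<notin> S" "c \<notin> S"
    using less abc za by (auto simp: S_def)
  have notin_D: "x v \<le> z v" if "v \<in> verts G" "v \<notin> D" for v
    using that z(3)[of v] by (auto simp: D_def)
  have out: "cur z e \<le> cur x e" if "e \<in> arcs G" "tail G e \<in> D" "head G e \<notin> D" for e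
    using that notin_D[of "head G e"] wellformed
    by (intro current_mono) (auto simp: voltage_def D_def)
  have into: "cur x e \<le> cur z e" if "e \<in> arcs G" "tail G e \<notin> D" "head G e \<in> D" for e
    using that notin_D[of "tail G e"] wellformed
    by (intro current_mono) (auto simp: voltage_def D_def)
  have "(\<Sum>v\<in>D. flx z v) = (\<Sum>v\<in>D. flx x v)"
    using sum_solution[OF x(1) abc(4) D(1), of "\<lambda>_. 1"]
      sum_solution[OF z(1) abc(5) D(1), of "\<lambda>_. 1"] D x(2) z(2) by simp
  note cross = cut_compare(2)[OF D(1) out into this]
  have D_out: "head G e = c"
    if e: "e \<in> arcs G" "tail G e \<in> D" "head G e \<notin> D" "cur x e > 0" for e
  proof (rule ccontr)
    assume "head G e \<noteq> c"
    let ?q = "head G e"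
    have eq: "cur z e = cur x e" using e by (intro cross) auto
    hence "volt z e = volt x e" using e by (intro current_inj) auto
    \<comment> \<open>Equal voltages make \<open>x\<close> and \<open>z\<close> agree at the head,
      which puts it at level \<open>x c\<close>, the minimum of \<open>z\<close>. No
      \<open>z\<close>-current leaves such a node, so as an inner node it receives none.\<close>
    hence zq: "z ?q = x ?q"
      using notin_D[of ?q] e wellformed by (auto simp: voltage_def D_def)
    hence xq: "x ?q = x c" using e wellformed z(3)[of ?q] by (auto simp: D_def)
    have "?q \<noteq> a" using D e by auto
    hence "flx z ?q = 0"
      using z(1) \<open>?q \<noteq> c\<close> e wellformed by (auto simp: is_solution_def)
    moreover have "cur z e' = 0" if "e' \<in> out_arcs G ?q" for e'
      using that z(3)[of "head G e'"] zq xq by (auto simp: current_zero_iff voltage_def)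
    ultimately have "(\<Sum>e'\<in>in_arcs G ?q. cur z e') = 0" by (simp add: flux_def)
    hence "cur z e = 0"
      using e(1) by (subst (asm) sum_nonneg_eq_0_iff) (auto simp: current_nonneg)
    thus False using eq e by simp
  qed
  have "(\<Sum>v\<in>S. flx x v) = 0"
    using sum_solution[OF x(1) abc(4) S(1), of "\<lambda>_. 1"] S by simp
  \<comment> \<open>Current into \<open>S\<close> would come from a higher node outside
    \<open>S\<close>, thus from \<open>D\<close>; but \<open>D\<close> discharges only into
    \<open>c\<close>.\<close>
  moreover have "cur x e = 0" if e: "e \<in> arcs G" "tail G e \<notin> S" "head G e \<in> S" for e
  proof (rule ccontr)
    assume "cur x e \<noteq> 0"
    hence pos: "cur x e > 0" using current_nonneg[of x e] by simp
    hence "x (tail G e) > x (head G e)" using e by (simp add: current_pos_iff voltage_def)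
    hence "tail G e \<in> D" using e wellformed by (auto simp: S_def D_def)
    moreover have "head G e \<notin> D" using e by (auto simp: S_def D_def)
    ultimately show False using D_out[of e] pos e S by auto
  qed
  ultimately have S_out: "cur x e = 0" if "e \<in> arcs G" "tail G e \<in> S" "head G e \<notin> S" for e
    using cut_balance[OF S(1), of x] that by auto
  \<comment> \<open>The path drops to level \<open>x c\<close> along an arc with positive current
    and head other than \<open>c\<close>. Its tail lies in \<open>D\<close> or \<open>S\<close>, and
    neither has such an exit.\<close>
  obtain e where e: "e \<in> set p" "x (tail G e) > x c" "x (head G e) \<le> x c"
    using awalk_leaves[OF p, of "{v. x v > x c}"] less by (auto simp: not_less)
  have eG: "e \<in> arcs G" using e p by auto
  have "head G e \<noteq> c" using nc e awalk_verts_arc2[OF p] by auto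
  moreover have pos: "cur x e > 0" using eG e by (simp add: current_pos_iff voltage_def)
  moreover have "head G e \<notin> D" "head G e \<notin> S" using e by (auto simp: D_def S_def)
  ultimately have "tail G e \<notin> D" "tail G e \<notin> S"
    using D_out[of e] S_out[of e] eG by auto
  thus False using e eG wellformed by (auto simp: D_def S_def)
qed

section \<open>The triangle inequality and its equality case\<close>

text \<open>Coinciding nodes and missing walks are settled by the values 0 and infinity. In the
  remaining case all three terms are finite voltages of unit flows.\<close>

lemma resistance_triangle:
  assumes abc: "a \<in> verts G" "b \<in> verts G" "c \<in> verts G"
  shows "ennreal_powr (effective_resistance G \<mu> r s a b) (s / r)
           \<le> ennreal_powr (effective_resistance G \<mu> r s a c) (s / r)
             + ennreal_powr (effective_resistance G \<mu> r s c b) (s / r) \<and>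
         (ennreal_powr (effective_resistance G \<mu> r s a b) (s / r)
           = ennreal_powr (effective_resistance G \<mu> r s a c) (s / r)
             + ennreal_powr (effective_resistance G \<mu> r s c b) (s / r) \<longleftrightarrow>
          (\<forall>p. apath a p b \<longrightarrow> c \<in> set (awalk_verts a p)))"
    (is "?R a b \<le> ?R a c + ?R c b \<and> (_ \<longleftrightarrow> ?through)")
proof -
  have pos: "?R u w \<noteq> 0" if uw: "u \<noteq> w" "u \<in> verts G" "w \<in> verts G" for u w
  proof (cases "\<exists>p. awalk u p w")
    case True
    then obtain R where "R > 0" "?R u w = ennreal R"
      using unit_voltage_exists[OF uw] by metis
    thus ?thesis by simp
  qed (use effective_resistance_infinite uw in auto)
  consider "c = a" | "c = b" | "a = b" "c \<noteq> a" | "a \<noteq> b" "a \<noteq> c" "b \<noteq> c" by blast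
  thus ?thesis
  proof cases
    case 1
    thus ?thesis
      by (auto simp: ennreal_powr_effective_resistance_self dest: hd_in_awalk_verts)
  next
    case 2
    thus ?thesis
      by (auto simp: ennreal_powr_effective_resistance_self
          dest: awalkI_apath last_in_awalk_verts)
  next
    case 3
    hence "apath a [] b" "c \<notin> set (awalk_verts a [])"
      using abc by (auto simp: apath_Nil_iff)
    hence "\<not> ?through" by blast
    thus ?thesis
      using 3 pos[of a c] abc by (auto simp: ennreal_powr_effective_resistance_self)
  next
    case 4
    show ?thesis
    proof (cases "\<exists>p. awalk a p b")
      case False
      hence "\<not> ((\<exists>p. awalk a p c) \<and> (\<exists>p. awalk c p b))"
        using awalk_appendI by blast
      hence "?R a c + ?R c b = \<infinity>"
        using effective_resistance_infinite 4 by auto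
      moreover have "?R a b = \<infinity>"
        using effective_resistance_infinite 4 False by auto
      moreover have ?through using False awalkI_apath by blast
      ultimately show ?thesis by auto
    next
      case True
      then obtain p0 where p0: "awalk a p0 b" by blast
      obtain Rab where Rab: "Rab > 0" "?R a b = ennreal Rab"
        "\<And>x xu xw. xu \<ge> xw \<Longrightarrow> is_solution G \<mu> r s a b xu xw x \<Longrightarrow>
          flx x a = 1 \<longleftrightarrow> xu - xw = Rab"
        using unit_voltage_exists[OF 4(1) abc(1,2) p0] by metis
      show ?thesis
      proof (cases "(\<exists>p. awalk a p c) \<and> (\<exists>p. awalk c p b)")
        case False
        hence "?R a c + ?R c b = \<infinity>"
          using effective_resistance_infinite 4 by auto
        moreover have "\<not> ?through"
          using apath_awalk_to_apath[OF p0] False awalk_decomp awalkI_apath by blast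
        ultimately show ?thesis by (auto simp: Rab(2))
      next
        case True
        obtain Rac where Rac: "Rac > 0" "?R a c = ennreal Rac"
          "\<And>x xu xw. xu \<ge> xw \<Longrightarrow> is_solution G \<mu> r s a c xu xw x \<Longrightarrow>
            flx x a = 1 \<longleftrightarrow> xu - xw = Rac"
          using unit_voltage_exists[OF 4(2) abc(1,3)] True by metis
        obtain Rcb where Rcb: "Rcb > 0" "?R c b = ennreal Rcb"
          "\<And>x xu xw. xu \<ge> xw \<Longrightarrow> is_solution G \<mu> r s c b xu xw x \<Longrightarrow>
            flx x c = 1 \<longleftrightarrow> xu - xw = Rcb"
          using unit_voltage_exists[OF 4(3)[symmetric] abc(3,2)] True by metis
        obtain x where x: "is_solution G \<mu> r s a b Rab 0 x"
          using solution_exists[OF abc(1,2) 4(1), of 0 Rab] Rab(1) by (metis less_imp_le)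
        have x1: "flx x a = 1" and xab: "x a = Rab" "x b = 0"
          using Rab(1,3) x by (auto simp: is_solution_def)
        \<comment> \<open>The boundary values of \<open>z\<close> and \<open>y\<close> are tied to
          \<open>x c\<close>: both flows have this level at \<open>c\<close>, where they can be
          glued.\<close>
        obtain z where z: "is_solution G \<mu> r s a c (x c + Rac) (x c) z" "\<And>v. x c \<le> z v"
          using solution_exists[OF abc(1,3) 4(2), of "x c" "x c + Rac"] Rac(1)
          by (metis le_add_same_cancel1 less_imp_le)
        have z1: "flx z a = 1" and zac: "z a = x c + Rac" "z c = x c"
          using Rac(1,3) z by (auto simp: is_solution_def)
        obtain y where y: "is_solution G \<mu> r s c b (x c) (x c - Rcb) y" "\<And>v. y v \<le> x c"
          using solution_exists[OF abc(3,2) 4(3)[symmetric], of "x c - Rcb" "x c"] Rcb(1)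
          by (metis diff_le_eq le_add_same_cancel1 less_imp_le)
        have y1: "flx y c = 1" and ycb: "y c = x c" "y b = x c - Rcb"
          using Rcb(1,3) y by (auto simp: is_solution_def)
        have le1: "x a - x c \<le> Rac"
          using unit_flow_voltage_le_source[OF abc 4 x x1 z(1) z1] zac by simp
        have le2: "x c - x b \<le> Rcb"
          using unit_flow_voltage_le_sink[OF abc 4 x x1 y(1) y1] ycb by simp
        have le: "Rab \<le> Rac + Rcb" using le1 le2 xab by simp
        have "Rab = Rac + Rcb \<longleftrightarrow> ?through"
        proof
          assume "Rab = Rac + Rcb"
          hence eq: "x a - x c = Rac" "x c - x b = Rcb" using le1 le2 xab by simp_all
          hence "is_solution G \<mu> r s a c (x a) (x c) z" using z by (simp add: algebra_simps)
          from path_through_of_unit_flow_voltage_eq[OF abc 4 x x1 this z1 z(2)] eq Rac(1) Rcb(1)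
          show ?through using awalkI_apath by simp
        next
          assume through: ?through
          \<comment> \<open>The nodes reachable from \<open>a\<close> while avoiding
            \<open>c\<close>: any arc leaving this set must end at \<open>c\<close>, as gluing
            requires.\<close>
          define A where "A = {v. \<exists>p. awalk a p v \<and> c \<notin> set (awalk_verts a p)}"
          have A_sub: "A \<subseteq> verts G" unfolding A_def by auto
          have a_A: "a \<in> A"
            unfolding A_def using abc 4 by (auto intro!: exI[of _ "[]"] simp: awalk_Nil_iff)
          have c_A: "c \<notin> A"
            unfolding A_def by (auto dest: last_in_awalk_verts)
          have b_A: "b \<notin> A"
          proof
            assume "b \<in> A"
            then obtain p where p: "awalk a p b" "c \<notin> set (awalk_verts a p)"
              by (auto simp: A_def)
            have q: "apath a (awalk_to_apath p) b" by (rule apath_awalk_to_apath[OF p(1)])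
            have "set (awalk_verts a (awalk_to_apath p)) \<subseteq> set (awalk_verts a p)"
              using awalk_to_apath_subset[OF p(1)] set_awalk_verts[OF p(1)]
                set_awalk_verts[OF awalkI_apath[OF q]] by auto
            thus False using through q p(2) by blast
          qed
          have A_out: "head G e = c"
            if e: "e \<in> arcs G" "tail G e \<in> A" "head G e \<notin> A" for e
          proof (rule ccontr)
            assume "head G e \<noteq> c"
            obtain p where p: "awalk a p (tail G e)" "c \<notin> set (awalk_verts a p)"
              using e by (auto simp: A_def)
            have "awalk a (p @ [e]) (head G e)"
              using awalk_appendI[OF p(1) arc_implies_awalk[OF e(1)]] .
            moreover have "c \<notin> set (awalk_verts a (p @ [e]))"
              using set_awalk_verts_append[OF p(1) arc_implies_awalk[OF e(1)]] p(2)
                \<open>head G e \<noteq> c\<close> e(2) c_A by auto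
            ultimately show False using e(3) by (auto simp: A_def)
          qed
          note glued = glue_solutions[OF A_sub a_A b_A c_A A_out abc(2,3) 4(3) z z1 y y1]
          have "x c - Rcb \<le> x c + Rac" using Rac(1) Rcb(1) by simp
          from Rab(3)[OF this glued(1)] glued(2) show "Rab = Rac + Rcb" by simp
        qed
        moreover have "?R a c + ?R c b = ennreal (Rac + Rcb)"
          using Rac(1) Rcb(1) unfolding Rac(2) Rcb(2) by simp
        moreover have "ennreal Rab \<le> ennreal (Rac + Rcb)"
          using le by (rule ennreal_leI)
        moreover have "ennreal Rab = ennreal (Rac + Rcb) \<longleftrightarrow> Rab = Rac + Rcb"
          using Rab(1) Rac(1) Rcb(1) by (intro ennreal_inj) auto
        ultimately show ?thesis unfolding Rab(2) by (simp only: simp_thms)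
      qed
    qed
  qed
qed

end

theorem theorem1:
  fixes G :: "('a, 'b) pre_digraph" and \<mu> :: "'b \<Rightarrow> real" and r s :: real and a b c :: 'a
  assumes "fin_digraph G"
    and "\<And>e. e \<in> arcs G \<Longrightarrow> \<mu> e > 0"
    and "r > 0" and "s > 0"
    and "a \<in> verts G" and "b \<in> verts G" and "c \<in> verts G"
  shows "ennreal_powr (effective_resistance G \<mu> r s a b) (s / r)
           \<le> ennreal_powr (effective_resistance G \<mu> r s a c) (s / r)
             + ennreal_powr (effective_resistance G \<mu> r s c b) (s / r) \<and>
         (ennreal_powr (effective_resistance G \<mu> r s a b) (s / r)
           = ennreal_powr (effective_resistance G \<mu> r s a c) (s / r)
             + ennreal_powr (effective_resistance G \<mu> r s c b) (s / r) \<longleftrightarrow>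
          (\<forall>p. pre_digraph.apath G a p b \<longrightarrow> c \<in> set (pre_digraph.awalk_verts G a p)))"
proof -
  interpret fin_digraph G by fact
  interpret circuit G \<mu> r s
    by unfold_locales (use assms in auto)
  show ?thesis using assms by (intro resistance_triangle)
qed

end
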